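(* Let $n$ be a positive integer, let $(\Omega, \mathscr{F}, \mathbb{P})$ be a probability space, let $(S, \mathscr{S})$ be an arbitrary measurable space, and let $X_1, \ldots, X_n$ be random variables on $(\Omega, \mathscr{F}, \mathbb{P})$ with values in $(S, \mathscr{S})$. Suppose that the law of $X = (X_1, \ldots, X_n)$ is exchangeable. Then there is a bounded signed measure $\xi$ on $\mathscr{P}(S)$ such that $$\mathbb{P}(X \in A) = \int_{\mathscr{P}(S)} \pi^n(A)\, \xi(d\pi), \qquad \text{for all } A \in \mathscr{S}^n,$$ where $\pi^n$ is the product of $n$ copies of $\pi \in \mathscr{P}(S)$.
   Context: $\mathscr{S}^n$ denotes the product $\sigma$-algebra on $S^n$. Random variables with values in $(S,\mathscr{S})$ are measurable functions from $(\Omega,\mathscr{F})$ into $(S,\mathscr{S})$. The law of $X=(X_1,\ldots,X_n)$ is exchangeable if, for every permutation $\sigma$ of $\{1,\ldots,n\}$ and every $B \in \mathscr{S}^n$, $\mathbb{P}((X_{\sigma(1)},\ldots,X_{\sigma(n)}) \in B) = \mathbb{P}(X \in B)$. $\mathscr{P}(S)$ denotes the set of all probability measures on $(S,\mathscr{S})$, equipped with the $\sigma$-algebra generated by the sets $\{\pi \in \mathscr{P}(S) : \pi(B) \le t\}$, $B \in \mathscr{S}$, $t \in \mathbb{R}$. For $\pi \in \mathscr{P}(S)$, $\pi^n$ is the product probability measure of $\pi$ with itself $n$ times on $(S^n, \mathscr{S}^n)$. A bounded signed measure is a finite (real-valued) countably additive set function; $\xi$ is a bounded signed measure on $\mathscr{P}(S)$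 with respect to the $\sigma$-algebra generated by the sets $\{\pi \in \mathscr{P}(S) : \pi(B) \le t\}$, $B \in \mathscr{S}$, $t \in \mathbb{R}$. No topological or other assumption is made on $(S,\mathscr{S})$. *)

theory Defs
  imports "HOL-Probability.Probability"
begin

definition exchangeable :: "'a measure \<Rightarrow> 's measure \<Rightarrow> nat \<Rightarrow> (nat \<Rightarrow> 'a \<Rightarrow> 's) \<Rightarrow> bool" where
  "exchangeable M S n X \<longleftrightarrow>
     (\<forall>\<sigma>. \<sigma> permutes {1..n} \<longrightarrow>
       (\<forall>B\<in>sets (PiM {1..n} (\<lambda>_. S)).
          measure M {\<omega> \<in> space M. (\<lambda>i\<in>{1..n}. X (\<sigma> i) \<omega>) \<in> B} =
          measure M {\<omega> \<in> space M. (\<lambda>i\<in>{1..n}. X i \<omega>) \<in> B}))"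

(* The space of probability measures on S is the library's prob_algebra S, whose sigma-algebra is
   built from the emeasure evaluations on subprobability measures. It is the one generated by
   the sets {p. p(B) \<le> t}: *)
lemma sets_prob_algebra_eq_sigma_sets:
  "sets (prob_algebra S) = sigma_sets (space (prob_algebra S))
     {{p \<in> space (prob_algebra S). measure p B \<le> t} | B t. B \<in> sets S}"
    (is "_ = sigma_sets ?P ?G")
proof
  have G: "?G \<subseteq> Pow ?P" by auto
  define N where "N = sigma ?P ?G"
  have sN: "space N = ?P" and setN: "sets N = sigma_sets ?P ?G"
    using G by (auto simp: N_def)
  have id: "(\<lambda>p. p) \<in> measurable N (prob_algebra S)"
  proof (rule measurable_prob_algebraI)
    show "prob_space p" if "p \<in> space N" for p
      using that by (simp add: sN space_prob_algebra)
    show "(\<lambda>p. p) \<in> measurable N (subprob_algebra S)"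
    proof (rule measurable_subprob_algebra)
      fix p assume p: "p \<in> space N"
      then have "prob_space p" by (simp add: sN space_prob_algebra)
      then show "subprob_space p" by (rule prob_space_imp_subprob_space)
      show "sets p = sets S" using p by (simp add: sN space_prob_algebra)
    next
      fix B assume B: "B \<in> sets S"
      have "(\<lambda>p. measure p B) \<in> borel_measurable N"
        unfolding borel_measurable_iff_le
        using B by (auto simp: sN setN intro!: sigma_sets.Basic)
      then have "(\<lambda>p. ennreal (measure p B)) \<in> borel_measurable N" by measurable
      also have "?this \<longleftrightarrow> (\<lambda>p. emeasure p B) \<in> borel_measurable N"
      proof (rule measurable_cong)
        fix p assume "p \<in> space N"
        then interpret prob_space p by (simp add: sN space_prob_algebra)
        show "ennreal (measure p B) = emeasure p B" by (simp add: emeasure_eq_measure)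
      qed
      finally show "(\<lambda>p. emeasure p B) \<in> borel_measurable N" .
    qed
  qed
  show "sets (prob_algebra S) \<subseteq> sigma_sets ?P ?G"
  proof
    fix A assume A: "A \<in> sets (prob_algebra S)"
    have "(\<lambda>p. p) -` A \<inter> space N = A"
      using sets.sets_into_space[OF A] by (auto simp: sN)
    then show "A \<in> sigma_sets ?P ?G"
      using measurable_sets[OF id A] by (simp add: setN)
  qed
next
  have "{p \<in> ?P. measure p B \<le> t} \<in> sets (prob_algebra S)" if B: "B \<in> sets S" for B t
  proof -
    have "(\<lambda>p. measure p B) \<in> borel_measurable (prob_algebra S)"
      by (rule measurable_compose[OF measurable_prob_algebraD[OF measurable_ident_sets[OF refl]]
            measurable_measure_subprob_algebra[OF B]])
    then show ?thesis by (simp add: borel_measurable_iff_le)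
  qed
  then show "sigma_sets ?P ?G \<subseteq> sets (prob_algebra S)"
    by (intro sets.sigma_sets_subset) auto
qed

(* Only the values of xi on sets N matter; being real-valued, xi is automatically bounded. *)
definition bounded_signed_measure :: "'c measure \<Rightarrow> ('c set \<Rightarrow> real) \<Rightarrow> bool" where
  "bounded_signed_measure N \<xi> \<longleftrightarrow>
     \<xi> {} = 0 \<and>
     (\<forall>A. range A \<subseteq> sets N \<longrightarrow> disjoint_family A \<longrightarrow> (\<lambda>i::nat. \<xi> (A i)) sums \<xi> (\<Union>i. A i))"

(* The positive part of xi in the Jordan decomposition; the truncation of negative values to 0
   by ennreal is harmless, since B = {} contributes the value 0. The negative part of xi is the
   positive part of - xi. *)
definition jordan_pos :: "'c measure \<Rightarrow> ('c set \<Rightarrow> real) \<Rightarrow> 'c measure" where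
  "jordan_pos N \<xi> = measure_of (space N) (sets N)
     (\<lambda>A. SUP B\<in>{B \<in> sets N. B \<subseteq> A}. ennreal (\<xi> B))"

definition signed_integral :: "'c measure \<Rightarrow> ('c set \<Rightarrow> real) \<Rightarrow> ('c \<Rightarrow> real) \<Rightarrow> real" where
  "signed_integral N \<xi> f =
     (\<integral>x. f x \<partial>jordan_pos N \<xi>) - (\<integral>x. f x \<partial>jordan_pos N (\<lambda>A. - \<xi> A))"

end

theory Submission
  imports Defs
begin

text \<open>
  Polarization: in a tensor power the sum of \<open>x (\<sigma> 1) \<otimes> \<dots> \<otimes> x (\<sigma> n)\<close> over all permutations \<open>\<sigma>\<close> equals
  the sum of \<open>(-1) ^ (n - |I|) * (\<Sum>i\<in>I. x i) ^ n\<close> over all subsets \<open>I\<close> of \<open>{1..n}\<close>. Take for \<open>x i\<close> the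
  Dirac measure at \<open>X i\<close>. By exchangeability the expectation of the left-hand side is \<open>n!\<close> times the
  law of \<open>X\<close>, while \<open>\<Sum>i\<in>I. x i\<close> is \<open>|I|\<close> times the empirical measure of the \<open>X i\<close> with \<open>i \<in> I\<close>. Hence
  \<open>\<xi>\<close> can be taken to be the sum over nonempty \<open>I\<close> of \<open>(-1) ^ (n - |I|) * |I| ^ n / n!\<close> times the law
  of this random empirical measure.
\<close>

section \<open>Signed measures as linear combinations of finite measures\<close>

text \<open>Countable additivity comes from exchanging a finite sum with a series in
  \<open>ennreal\<close>. With nonnegative coefficients this realizes the two halves of a signed
  combination as genuine measures.\<close>

lemma ex_weighted_sum_measure:
  fixes c :: "'i \<Rightarrow> ennreal"
  assumes "finite I" and sets: "\<And>i. i \<in> I \<Longrightarrow> sets (\<mu> i) = sets N"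
  shows "\<exists>P. sets P = sets N \<and> (\<forall>A\<in>sets N. emeasure P A = (\<Sum>i\<in>I. c i * emeasure (\<mu> i) A))"
proof -
  define P where "P = measure_of (space N) (sets N) (\<lambda>A. \<Sum>i\<in>I. c i * emeasure (\<mu> i) A)"
  have "emeasure P A = (\<Sum>i\<in>I. c i * emeasure (\<mu> i) A)" if "A \<in> sets N" for A
  proof (rule emeasure_measure_of[OF P_def])
    show "countably_additive (sets P) (\<lambda>A. \<Sum>i\<in>I. c i * emeasure (\<mu> i) A)"
    proof (rule countably_additiveI)
      fix B :: "nat \<Rightarrow> _" assume B: "range B \<subseteq> sets P" "disjoint_family B"
      have "(\<Sum>k. \<Sum>i\<in>I. c i * emeasure (\<mu> i) (B k)) = (\<Sum>i\<in>I. \<Sum>k. c i * emeasure (\<mu> i) (B k))"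
        by (rule suminf_sum) simp
      also have "\<dots> = (\<Sum>i\<in>I. c i * emeasure (\<mu> i) (\<Union>k. B k))"
        using B sets by (intro sum.cong) (auto simp: suminf_emeasure P_def sets.space_closed)
      finally show "(\<Sum>k. \<Sum>i\<in>I. c i * emeasure (\<mu> i) (B k)) = (\<Sum>i\<in>I. c i * emeasure (\<mu> i) (\<Union>k. B k))" .
    qed
  qed (use that in \<open>auto simp: P_def positive_def sets.space_closed\<close>)
  moreover have "sets P = sets N"
    by (simp add: P_def sets.space_closed)
  ultimately show ?thesis by blast
qed

lemma bounded_signed_measure_sums:
  assumes "bounded_signed_measure N \<xi>" "range A \<subseteq> sets N" "disjoint_family A"
  shows "(\<lambda>i::nat. \<xi> (A i)) sums \<xi> (\<Union>i. A i)"
  using assms by (simp add: bounded_signed_measure_def)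

lemma bounded_signed_measure_sum:
  assumes "finite I" "\<And>i. i \<in> I \<Longrightarrow> finite_measure (\<mu> i)" "\<And>i. i \<in> I \<Longrightarrow> sets (\<mu> i) = sets N"
  shows "bounded_signed_measure N (\<lambda>A. \<Sum>i\<in>I. c i * measure (\<mu> i) A)"
  unfolding bounded_signed_measure_def
  using assms by (auto intro!: sums_sum sums_mult finite_measure.finite_measure_UNION)

text \<open>Splitting each coefficient into positive and negative part writes \<open>\<xi>\<close>
  as a difference of finite measures \<open>P\<close> and \<open>Q\<close>. A Hahn set for this
  pair, where \<open>Q \<le> P\<close> inside and \<open>P \<le> Q\<close> outside, is then a Hahn
  set for \<open>\<xi>\<close>.\<close>

lemma Hahn_decomposition_sum:
  fixes c :: "'i \<Rightarrow> real"
  assumes fin: "finite I" and fm: "\<And>i. i \<in> I \<Longrightarrow> finite_measure (\<mu> i)"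
    and sets: "\<And>i. i \<in> I \<Longrightarrow> sets (\<mu> i) = sets N"
  defines "\<xi> \<equiv> \<lambda>A. \<Sum>i\<in>I. c i * measure (\<mu> i) A"
  obtains Y where "Y \<in> sets N" "\<And>A. A \<in> sets N \<Longrightarrow> A \<subseteq> Y \<Longrightarrow> 0 \<le> \<xi> A"
    "\<And>A. A \<in> sets N \<Longrightarrow> A \<inter> Y = {} \<Longrightarrow> \<xi> A \<le> 0"
proof -
  have fin_sum: "(\<Sum>i\<in>I. ennreal (d i) * emeasure (\<mu> i) A) = ennreal (\<Sum>i\<in>I. d i * measure (\<mu> i) A)"
    if "\<And>i. 0 \<le> d i" for d A
    using fm that
    by (simp add: sum_nonneg finite_measure.emeasure_eq_measure ennreal_mult'' flip: sum_ennreal)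
  have ex: "\<exists>P. sets P = sets N \<and>
      (\<forall>A\<in>sets N. emeasure P A = ennreal (\<Sum>i\<in>I. d i * measure (\<mu> i) A))"
    if "\<And>i. 0 \<le> d i" for d
    using ex_weighted_sum_measure[where c = "\<lambda>i. ennreal (d i)" and \<mu> = \<mu>, OF fin sets]
    unfolding fin_sum[OF that] by simp
  obtain P where P: "sets P = sets N"
    "\<And>A. A \<in> sets N \<Longrightarrow> emeasure P A = ennreal (\<Sum>i\<in>I. max 0 (c i) * measure (\<mu> i) A)"
    using ex[of "\<lambda>i. max 0 (c i)"] by auto
  obtain Q where Q: "sets Q = sets N"
    "\<And>A. A \<in> sets N \<Longrightarrow> emeasure Q A = ennreal (\<Sum>i\<in>I. max 0 (- c i) * measure (\<mu> i) A)"
    using ex[of "\<lambda>i. max 0 (- c i)"] by auto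
  have PQ: "finite_measure P" "finite_measure Q"
    using sets_eq_imp_space_eq[OF P(1)] sets_eq_imp_space_eq[OF Q(1)] P Q
    by (auto intro!: finite_measureI)
  have \<xi>: "\<xi> A = (\<Sum>i\<in>I. max 0 (c i) * measure (\<mu> i) A) - (\<Sum>i\<in>I. max 0 (- c i) * measure (\<mu> i) A)" for A
    unfolding \<xi>_def sum_subtractf[symmetric] by (intro sum.cong) (auto simp: max_def algebra_simps)
  obtain Y where "Y \<in> sets P"
    "\<And>A. A \<in> sets P \<Longrightarrow> A \<subseteq> Y \<Longrightarrow> emeasure Q A \<le> emeasure P A"
    "\<And>A. A \<in> sets P \<Longrightarrow> A \<inter> Y = {} \<Longrightarrow> emeasure P A \<le> emeasure Q A"
    using finite_unsigned_Hahn_decomposition[OF PQ] P Q by auto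
  then show thesis
    using P Q by (intro that[of Y]) (auto simp: \<xi> sum_nonneg)
qed

section \<open>Jordan parts of a signed measure with a Hahn set, and integrals against it\<close>

lemma bounded_signed_measure_Un:
  assumes \<xi>: "bounded_signed_measure N \<xi>" and "A \<in> sets N" "B \<in> sets N" "A \<inter> B = {}"
  shows "\<xi> (A \<union> B) = \<xi> A + \<xi> B"
proof -
  have "(\<lambda>i. \<xi> (binaryset A B i)) sums \<xi> (\<Union>i. binaryset A B i)"
    using assms
    by (intro bounded_signed_measure_sums[OF \<xi>])
      (auto simp: range_binaryset_eq disjoint_family_on_def binaryset_def)
  moreover have "(\<lambda>i. \<xi> (binaryset A B i)) sums (\<xi> A + \<xi> B)"
    using \<xi> by (intro binaryset_sums) (simp add: bounded_signed_measure_def)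
  ultimately show ?thesis
    by (simp add: UN_binaryset_eq sums_unique2)
qed

text \<open>Passing from a subset \<open>B\<close> of \<open>A\<close> to
  \<open>A \<inter> Y\<close> can only increase \<open>\<xi>\<close>, so the supremum defining
  \<open>jordan_pos\<close> is attained at \<open>A \<inter> Y\<close>. The resulting set function
  inherits countable additivity from \<open>\<xi>\<close>.\<close>

lemma jordan_pos_Hahn:
  assumes \<xi>: "bounded_signed_measure N \<xi>" and Y[measurable]: "Y \<in> sets N"
    and pos: "\<And>A. A \<in> sets N \<Longrightarrow> A \<subseteq> Y \<Longrightarrow> 0 \<le> \<xi> A"
    and neg: "\<And>A. A \<in> sets N \<Longrightarrow> A \<inter> Y = {} \<Longrightarrow> \<xi> A \<le> 0"
  shows "sets (jordan_pos N \<xi>) = sets N" "finite_measure (jordan_pos N \<xi>)"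
    "\<And>A. A \<in> sets N \<Longrightarrow> measure (jordan_pos N \<xi>) A = \<xi> (A \<inter> Y)"
proof -
  let ?f = "\<lambda>A. SUP B\<in>{B \<in> sets N. B \<subseteq> A}. ennreal (\<xi> B)"
  have f: "?f A = ennreal (\<xi> (A \<inter> Y))" if [measurable]: "A \<in> sets N" for A
  proof (rule antisym)
    show "?f A \<le> ennreal (\<xi> (A \<inter> Y))"
    proof (rule SUP_least)
      fix B assume "B \<in> {B \<in> sets N. B \<subseteq> A}"
      then have [measurable]: "B \<in> sets N" and B: "B \<subseteq> A" by auto
      \<comment> \<open>Discarding \<open>B - Y\<close> removes a nonpositive amount and adding
        \<open>(A - B) \<inter> Y\<close> supplies a nonnegative one, whence \<open>\<xi> B \<le>
        \<xi> (B \<inter> Y) \<le> \<xi> (A \<inter> Y)\<close>.\<close>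
      have "\<xi> ((B \<inter> Y) \<union> (B - Y)) = \<xi> (B \<inter> Y) + \<xi> (B - Y)"
        by (rule bounded_signed_measure_Un[OF \<xi>]) auto
      moreover have "\<xi> ((B \<inter> Y) \<union> ((A - B) \<inter> Y)) = \<xi> (B \<inter> Y) + \<xi> ((A - B) \<inter> Y)"
        by (rule bounded_signed_measure_Un[OF \<xi>]) auto
      moreover have "(B \<inter> Y) \<union> (B - Y) = B" "(B \<inter> Y) \<union> ((A - B) \<inter> Y) = A \<inter> Y"
        using B by auto
      moreover have "\<xi> (B - Y) \<le> 0" "0 \<le> \<xi> ((A - B) \<inter> Y)"
        by (auto intro!: pos neg)
      ultimately show "ennreal (\<xi> B) \<le> ennreal (\<xi> (A \<inter> Y))"
        by (intro ennreal_leI) simp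
    qed
  qed (auto intro!: SUP_upper)
  show sets: "sets (jordan_pos N \<xi>) = sets N"
    by (simp add: jordan_pos_def sets.space_closed)
  have em: "emeasure (jordan_pos N \<xi>) A = ennreal (\<xi> (A \<inter> Y))" if "A \<in> sets N" for A
    unfolding f[OF that, symmetric]
  proof (rule emeasure_measure_of[OF jordan_pos_def])
    show "countably_additive (sets (jordan_pos N \<xi>)) ?f"
    proof (rule countably_additiveI)
      fix B :: "nat \<Rightarrow> _"
      assume B: "range B \<subseteq> sets (jordan_pos N \<xi>)" "disjoint_family B"
        "(\<Union>i. B i) \<in> sets (jordan_pos N \<xi>)"
      have Bi[measurable]: "B i \<in> sets N" for i
        using B(1) unfolding sets by blast
      have "(\<lambda>i. \<xi> (B i \<inter> Y)) sums \<xi> (\<Union>i. B i \<inter> Y)"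
        using B(2) by (intro bounded_signed_measure_sums[OF \<xi>]) (auto simp: disjoint_family_on_def)
      \<comment> \<open>The terms are nonnegative inside \<open>Y\<close>, so \<open>ennreal\<close>
        truncates nothing and the real series carries over.\<close>
      then have "(\<Sum>i. ennreal (\<xi> (B i \<inter> Y))) = ennreal (\<xi> (\<Union>i. B i \<inter> Y))"
        by (intro suminf_ennreal_eq pos) auto
      moreover have "(\<Union>i. B i \<inter> Y) = (\<Union>i. B i) \<inter> Y" by auto
      ultimately show "(\<Sum>i. ?f (B i)) = ?f (\<Union>i. B i)"
        using B by (simp add: f sets)
    qed
    show "positive (sets (jordan_pos N \<xi>)) ?f"
      using \<xi> f[of "{}"] by (simp add: positive_def bounded_signed_measure_def)
  qed (use that sets in \<open>auto simp: sets.space_closed\<close>)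
  show "measure (jordan_pos N \<xi>) A = \<xi> (A \<inter> Y)" if "A \<in> sets N" for A
    using that by (simp add: measure_def em pos)
  show "finite_measure (jordan_pos N \<xi>)"
    using sets sets_eq_imp_space_eq[OF sets] by (intro finite_measureI) (simp add: em)
qed

text \<open>Equality on sets is equality for indicators; it extends to \<open>f\<close> by linearity
  and monotone approximation.\<close>

lemma integral_diff_eq_sum:
  fixes f :: "'a \<Rightarrow> real"
  assumes "f \<in> borel_measurable N" "\<And>x. 0 \<le> f x"
    and "integrable P f" "integrable Q f" "\<And>i. i \<in> I \<Longrightarrow> integrable (\<mu> i) f"
    and P[measurable_cong]: "sets P = sets N" and Q[measurable_cong]: "sets Q = sets N"
    and \<mu>[measurable_cong]: "\<And>i. i \<in> I \<Longrightarrow> sets (\<mu> i) = sets N"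
    and eq: "\<And>A. A \<in> sets N \<Longrightarrow> measure P A - measure Q A = (\<Sum>i\<in>I. c i * measure (\<mu> i) A)"
  shows "(\<integral>x. f x \<partial>P) - (\<integral>x. f x \<partial>Q) = (\<Sum>i\<in>I. c i * (\<integral>x. f x \<partial>\<mu> i))"
  \<comment> \<open>The integrability assumptions enter the induction as premises: a Bochner
    integral defaults to 0 on nonintegrable functions, so additivity and limits have to be justified
    for each function that occurs.\<close>
  using assms(1-5)
proof (induction rule: borel_measurable_induct_real)
  case (set A)
  have "space P = space N" "space Q = space N" "\<And>i. i \<in> I \<Longrightarrow> space (\<mu> i) = space N"
    by (rule sets_eq_imp_space_eq, simp add: P Q \<mu>)+
  moreover have "A \<inter> space N = A"
    using set sets.sets_into_space by blast
  ultimately show ?case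
    using eq[OF set(1)] by simp
next
  case (mult u a)
  show ?case
  \<comment> \<open>For \<open>a = 0\<close> integrability of the product says nothing about
    \<open>u\<close>, so the induction hypothesis is out of reach; but then both sides
    vanish.\<close>
  proof (cases "a = 0")
    case False
    with mult have "(\<integral>x. u x \<partial>P) - (\<integral>x. u x \<partial>Q) = (\<Sum>i\<in>I. c i * (\<integral>x. u x \<partial>\<mu> i))"
      by simp
    then show ?thesis
      by (simp add: sum_distrib_left mult.left_commute flip: right_diff_distrib)
  qed simp
next
  case (add u v)
  \<comment> \<open>Both summands are nonnegative, hence dominated by their sum.\<close>
  have "integrable R u \<and> integrable R v"
    if "integrable R (\<lambda>x. v x + u x)" "sets R = sets N" for R
    using add.hyps that measurable_cong_sets[OF that(2) refl]
    by (auto intro!: Bochner_Integration.integrable_bound[OF that(1)])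
  note int = this[OF add.prems(1) P] this[OF add.prems(2) Q] this[OF add.prems(3) \<mu>]
  from int add.IH show ?case
    by (simp add: distrib_left sum.distrib algebra_simps)
next
  case (seq U)
  \<comment> \<open>The limit in this case is \<open>f\<close> itself. As the \<open>U k\<close>
    increase to \<open>f\<close>, it dominates them all, which yields integrability and dominated
    convergence under every measure involved.\<close>
  have le: "U k x \<le> f x" if "x \<in> space N" for k x
    using seq that by (intro incseq_le) (auto simp: incseq_def le_fun_def)
  have lim: "integrable R (U k)" "(\<lambda>k. integral\<^sup>L R (U k)) \<longlonglongrightarrow> integral\<^sup>L R f"
    if R: "integrable R f" "sets R = sets N" for R k
  proof -
    note m = measurable_cong_sets[OF R(2) refl]
    note sp = sets_eq_imp_space_eq[OF R(2)]
    show "integrable R (U k)"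
      using seq.hyps
      by (intro Bochner_Integration.integrable_bound[OF R(1)])
        (auto simp: m sp intro!: AE_I2 order_trans[OF le abs_ge_self])
    show "(\<lambda>k. integral\<^sup>L R (U k)) \<longlonglongrightarrow> integral\<^sup>L R f"
      using seq.hyps assms(1) R le
      by (intro integral_dominated_convergence[where w = f]) (auto simp: m sp intro!: AE_I2)
  qed
  have "(\<lambda>k. (\<integral>x. U k x \<partial>P) - (\<integral>x. U k x \<partial>Q)) \<longlonglongrightarrow> (\<integral>x. f x \<partial>P) - (\<integral>x. f x \<partial>Q)"
    using seq.prems P Q by (intro tendsto_diff lim)
  moreover have "(\<lambda>k. \<Sum>i\<in>I. c i * (\<integral>x. U k x \<partial>\<mu> i)) \<longlonglongrightarrow> (\<Sum>i\<in>I. c i * (\<integral>x. f x \<partial>\<mu> i))"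
    using seq.prems \<mu> by (intro tendsto_sum tendsto_mult_left lim)
  moreover have "(\<integral>x. U k x \<partial>P) - (\<integral>x. U k x \<partial>Q) = (\<Sum>i\<in>I. c i * (\<integral>x. U k x \<partial>\<mu> i))" for k
    using seq.prems P Q \<mu> by (intro seq.IH lim)
  ultimately show ?case
    by (simp add: LIMSEQ_unique)
qed

text \<open>The \<open>\<mu> i\<close> may overlap, so splitting by the sign of the coefficients
  need not give the Jordan decomposition. The difference of the Jordan parts still agrees with the
  combination on every measurable set, and this determines the integrals. The bound \<open>K\<close>
  makes \<open>f\<close> integrable for all the finite measures.\<close>

lemma signed_integral_sum:
  fixes f :: "'a \<Rightarrow> real" and c :: "'i \<Rightarrow> real"
  assumes fin: "finite I" and fm: "\<And>i. i \<in> I \<Longrightarrow> finite_measure (\<mu> i)"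
    and \<mu>: "\<And>i. i \<in> I \<Longrightarrow> sets (\<mu> i) = sets N"
    and f: "f \<in> borel_measurable N" "\<And>x. 0 \<le> f x" "\<And>x. x \<in> space N \<Longrightarrow> f x \<le> K"
  shows "signed_integral N (\<lambda>A. \<Sum>i\<in>I. c i * measure (\<mu> i) A) f = (\<Sum>i\<in>I. c i * (\<integral>x. f x \<partial>\<mu> i))"
proof -
  define \<xi> where "\<xi> = (\<lambda>A. \<Sum>i\<in>I. c i * measure (\<mu> i) A)"
  have sm: "bounded_signed_measure N \<xi>"
    unfolding \<xi>_def by (rule bounded_signed_measure_sum[OF fin fm \<mu>])
  have sm': "bounded_signed_measure N (\<lambda>A. - \<xi> A)"
    using sm by (auto simp: bounded_signed_measure_def intro!: sums_minus)
  obtain Y where Y[measurable]: "Y \<in> sets N"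
    and pos: "\<And>A. A \<in> sets N \<Longrightarrow> A \<subseteq> Y \<Longrightarrow> 0 \<le> \<xi> A"
    and neg: "\<And>A. A \<in> sets N \<Longrightarrow> A \<inter> Y = {} \<Longrightarrow> \<xi> A \<le> 0"
    using Hahn_decomposition_sum[where c = c and \<mu> = \<mu>, OF fin fm \<mu>] unfolding \<xi>_def by blast
  note J = jordan_pos_Hahn[OF sm Y pos neg]
  \<comment> \<open>The complement of a Hahn set for \<open>\<xi>\<close> is a Hahn set for
    \<open>- \<xi>\<close>, so the same lemma computes the negative part.\<close>
  have pos': "0 \<le> - \<xi> A" if "A \<in> sets N" "A \<subseteq> space N - Y" for A
    using neg[OF that(1)] that(2) by auto
  have neg': "- \<xi> A \<le> 0" if "A \<in> sets N" "A \<inter> (space N - Y) = {}" for A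
    using pos[OF that(1)] that sets.sets_into_space[OF that(1)] by auto
  have Y': "space N - Y \<in> sets N" by simp
  note J' = jordan_pos_Hahn[OF sm' Y' pos' neg']
  have int: "integrable R f" if "finite_measure R" "sets R = sets N" for R
    using that f measurable_cong_sets[OF that(2) refl] sets_eq_imp_space_eq[OF that(2)]
    by (intro finite_measure.integrable_const_bound[of _ _ K]) auto
  have eq: "measure (jordan_pos N \<xi>) A - measure (jordan_pos N (\<lambda>A. - \<xi> A)) A = \<xi> A"
    if [measurable]: "A \<in> sets N" for A
  proof -
    have "\<xi> ((A \<inter> Y) \<union> (A \<inter> (space N - Y))) = \<xi> (A \<inter> Y) + \<xi> (A \<inter> (space N - Y))"
      by (rule bounded_signed_measure_Un[OF sm]) auto
    moreover have "(A \<inter> Y) \<union> (A \<inter> (space N - Y)) = A"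
      using sets.sets_into_space[OF that] by auto
    ultimately show ?thesis
      by (simp add: J J')
  qed
  have "(\<integral>x. f x \<partial>jordan_pos N \<xi>) - (\<integral>x. f x \<partial>jordan_pos N (\<lambda>A. - \<xi> A))
      = (\<Sum>i\<in>I. c i * (\<integral>x. f x \<partial>\<mu> i))"
  proof (rule integral_diff_eq_sum[OF f(1,2) int[OF J(2,1)] int[OF J'(2,1)] _ J(1) J'(1)])
    show "measure (jordan_pos N \<xi>) A - measure (jordan_pos N (\<lambda>A. - \<xi> A)) A
        = (\<Sum>i\<in>I. c i * measure (\<mu> i) A)" if "A \<in> sets N" for A
      using eq[OF that] by (simp only: \<xi>_def)
  qed (simp_all add: int fm \<mu>)
  then show ?thesis
    by (simp add: signed_integral_def \<xi>_def)
qed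

section \<open>Powers of empirical measures\<close>

text \<open>It suffices to test boxes, an intersection-stable generator; there the power measure is
  a finite product of evaluations of \<open>\<pi>\<close>.\<close>

lemma measurable_PiM_prob_algebra:
  assumes "finite K"
  shows "(\<lambda>\<pi>. PiM K (\<lambda>_. \<pi>)) \<in> measurable (prob_algebra S) (prob_algebra (PiM K (\<lambda>_. S)))"
proof (rule measurable_prob_algebra_generated[OF sets_PiM Int_stable_prod_algebra
      prod_algebra_sets_into_space])
  fix \<pi> assume "\<pi> \<in> space (prob_algebra S)"
  then show "prob_space (PiM K (\<lambda>_. \<pi>))" "sets (PiM K (\<lambda>_. \<pi>)) = sets (PiM K (\<lambda>_. S))"
    by (auto simp: space_prob_algebra intro!: prob_space_PiM sets_PiM_cong)
next
  fix A assume "A \<in> prod_algebra K (\<lambda>_. S)"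
  then obtain B where A: "A = (\<Pi>\<^sub>E i\<in>K. B i)" and B: "\<And>i. i \<in> K \<Longrightarrow> B i \<in> sets S"
    using assms by (auto simp: prod_algebra_eq_finite)
  have "emeasure (PiM K (\<lambda>_. \<pi>)) A = (\<Prod>i\<in>K. emeasure \<pi> (B i))"
    if "\<pi> \<in> space (prob_algebra S)" for \<pi>
  proof -
    from that have \<pi>: "prob_space \<pi>" "sets \<pi> = sets S"
      by (auto simp: space_prob_algebra)
    then interpret product_prob_space "\<lambda>_. \<pi>" K
      by (simp add: product_prob_space_def product_prob_space_axioms_def product_sigma_finite_def
          prob_space_imp_sigma_finite)
    show ?thesis
      using assms B \<pi> unfolding A by (intro emeasure_PiM) auto
  qed
  moreover have "(\<lambda>\<pi>. \<Prod>i\<in>K. emeasure \<pi> (B i)) \<in> borel_measurable (prob_algebra S)"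
    by (intro borel_measurable_prod_ennreal measurable_compose[OF measurable_prob_algebraD[OF
            measurable_ident_sets[OF refl]] measurable_emeasure_subprob_algebra] B)
  ultimately show "(\<lambda>\<pi>. emeasure (PiM K (\<lambda>_. \<pi>)) A) \<in> borel_measurable (prob_algebra S)"
    by (subst measurable_cong)
qed

text \<open>As an image of the uniform distribution it counts repeated values with multiplicity. The
  index type is arbitrary so that a power of an empirical measure can again be written as one,
  indexed by maps.\<close>

definition empirical :: "'s measure \<Rightarrow> 'i set \<Rightarrow> ('i \<Rightarrow> 's) \<Rightarrow> 's measure" where
  "empirical S I x = distr (uniform_count_measure I) S x"

lemma sets_empirical [simp]: "sets (empirical S I x) = sets S"
  by (simp add: empirical_def)

lemma
  assumes "finite I" "x \<in> I \<rightarrow> space S"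
  shows prob_space_empirical: "I \<noteq> {} \<Longrightarrow> prob_space (empirical S I x)"
    and emeasure_empirical: "B \<in> sets S \<Longrightarrow>
      emeasure (empirical S I x) B = ennreal (card {i\<in>I. x i \<in> B} / card I)"
proof -
  have x: "x \<in> measurable (uniform_count_measure I) S"
    using assms by (auto simp: measurable_def space_uniform_count_measure sets_uniform_count_measure)
  then show "I \<noteq> {} \<Longrightarrow> prob_space (empirical S I x)"
    using assms unfolding empirical_def
    by (intro prob_space.prob_space_distr prob_space_uniform_count_measure)
  have "x -` B \<inter> I = {i\<in>I. x i \<in> B}" by auto
  then show "emeasure (empirical S I x) B = ennreal (card {i\<in>I. x i \<in> B} / card I)"
    if "B \<in> sets S"
    using x that assms
    by (simp add: empirical_def emeasure_distr emeasure_uniform_count_measure space_uniform_count_measure)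
qed

text \<open>Evaluating at a measurable set gives an average of indicators of the \<open>X i\<close>,
  which is measurable in the sample point.\<close>

lemma measurable_empirical:
  assumes I: "finite I" "I \<noteq> {}" and X: "\<And>i. i \<in> I \<Longrightarrow> X i \<in> measurable M S"
  shows "(\<lambda>\<omega>. empirical S I (\<lambda>i. X i \<omega>)) \<in> measurable M (prob_algebra S)"
proof (rule measurable_prob_algebra_generated[OF sets.sigma_sets_eq[symmetric] sets.Int_stable
      sets.space_closed])
  have X': "(\<lambda>i. X i \<omega>) \<in> I \<rightarrow> space S" if "\<omega> \<in> space M" for \<omega>
    using X that by (auto dest: measurable_space)
  show "prob_space (empirical S I (\<lambda>i. X i \<omega>))" if "\<omega> \<in> space M" for \<omega>
    using I X'[OF that] by (intro prob_space_empirical)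
  fix B assume B: "B \<in> sets S"
  have "emeasure (empirical S I (\<lambda>i. X i \<omega>)) B
      = ennreal ((\<Sum>i\<in>I. indicator B (X i \<omega>)) / card I)" if "\<omega> \<in> space M" for \<omega>
    using I B X'[OF that]
    by (simp add: emeasure_empirical indicator_def sum.If_cases Int_def)
  moreover have "(\<lambda>\<omega>. ennreal ((\<Sum>i\<in>I. indicator B (X i \<omega>)) / card I)) \<in> borel_measurable M"
    using X B by (intro measurable_compose[OF _ measurable_ennreal] borel_measurable_divide
        borel_measurable_sum measurable_compose[OF _ borel_measurable_indicator]) auto
  ultimately show "(\<lambda>\<omega>. emeasure (empirical S I (\<lambda>i. X i \<omega>)) B) \<in> borel_measurable M"
    by (subst measurable_cong)
qed simp

text \<open>Independent uniform choices from \<open>I\<close>, one for each element of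
  \<open>K\<close>, amount to a uniform choice of a map from \<open>K\<close> to \<open>I\<close>.
  Both sides are compared on boxes.\<close>

lemma PiM_empirical:
  assumes K: "finite K" and I: "finite I" "I \<noteq> {}" and x: "x \<in> I \<rightarrow> space S"
  shows "PiM K (\<lambda>_. empirical S I x)
    = empirical (PiM K (\<lambda>_. S)) (K \<rightarrow>\<^sub>E I) (\<lambda>\<phi>. \<lambda>i\<in>K. x (\<phi> i))"
proof -
  interpret prob_space "empirical S I x"
    by (rule prob_space_empirical[OF I(1) x I(2)])
  interpret product_sigma_finite "\<lambda>_. empirical S I x"
    by standard
  have fin: "finite (K \<rightarrow>\<^sub>E I)" using K I by (intro finite_PiE)
  have sp: "(\<lambda>\<phi>. \<lambda>i\<in>K. x (\<phi> i)) \<in> (K \<rightarrow>\<^sub>E I) \<rightarrow> space (PiM K (\<lambda>_. S))"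
    using x by (auto simp: space_PiM)
  show ?thesis
  proof (rule PiM_eqI[OF K, symmetric])
    fix B assume "\<And>i. i \<in> K \<Longrightarrow> B i \<in> sets (empirical S I x)"
    then have B: "\<And>i. i \<in> K \<Longrightarrow> B i \<in> sets S" by simp
    \<comment> \<open>A box constrains each coordinate of \<open>\<phi>\<close> separately, so the
      number of admissible maps factors over \<open>K\<close>.\<close>
    have "{\<phi> \<in> K \<rightarrow>\<^sub>E I. (\<lambda>i\<in>K. x (\<phi> i)) \<in> Pi\<^sub>E K B} = (\<Pi>\<^sub>E i\<in>K. {j\<in>I. x j \<in> B i})"
      by (auto simp: PiE_iff extensional_def)
    then have "emeasure (empirical (PiM K (\<lambda>_. S)) (K \<rightarrow>\<^sub>E I) (\<lambda>\<phi>. \<lambda>i\<in>K. x (\<phi> i))) (Pi\<^sub>E K B)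
        = ennreal (\<Prod>i\<in>K. card {j\<in>I. x j \<in> B i} / card I)"
      using K B by (simp add: emeasure_empirical[OF fin sp] sets_PiM_I_finite card_PiE prod_dividef)
    also have "\<dots> = (\<Prod>i\<in>K. emeasure (empirical S I x) (B i))"
      using B by (simp add: emeasure_empirical[OF I(1) x] prod_ennreal)
    finally show "emeasure (empirical (PiM K (\<lambda>_. S)) (K \<rightarrow>\<^sub>E I) (\<lambda>\<phi>. \<lambda>i\<in>K. x (\<phi> i))) (Pi\<^sub>E K B)
        = (\<Prod>i\<in>K. emeasure (empirical S I x) (B i))" .
  qed (simp cong: sets_PiM_cong)
qed

lemma measure_PiM_empirical:
  assumes K: "finite K" and I: "finite I" "I \<noteq> {}" and x: "x \<in> I \<rightarrow> space S"
    and A: "A \<in> sets (PiM K (\<lambda>_. S))"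
  shows "measure (PiM K (\<lambda>_. empirical S I x)) A
    = (\<Sum>\<phi>\<in>K \<rightarrow>\<^sub>E I. indicator A (\<lambda>i\<in>K. x (\<phi> i))) / real (card I) ^ card K"
proof -
  have fin: "finite (K \<rightarrow>\<^sub>E I)" using K I by (intro finite_PiE)
  have sp: "(\<lambda>\<phi>. \<lambda>i\<in>K. x (\<phi> i)) \<in> (K \<rightarrow>\<^sub>E I) \<rightarrow> space (PiM K (\<lambda>_. S))"
    using x by (auto simp: space_PiM)
  show ?thesis
    using K fin unfolding PiM_empirical[OF K I x] measure_def emeasure_empirical[OF fin sp A]
    by (simp add: card_PiE indicator_def sum.If_cases Int_def)
qed

section \<open>Polarization\<close>

text \<open>Taking complements turns the sum into the expansion of a product of factors
  \<open>- 1 + 1\<close>, one for each element of \<open>K - R\<close>.\<close>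

lemma sum_alternating_supersets:
  assumes K: "finite K" and R: "R \<subseteq> K"
  shows "(\<Sum>I | R \<subseteq> I \<and> I \<subseteq> K. (- 1) ^ card (K - I)) = (if R = K then 1 else 0 :: real)"
proof -
  have "(\<Sum>I | R \<subseteq> I \<and> I \<subseteq> K. (- 1) ^ card (K - I)) = (\<Sum>J\<in>Pow (K - R). (- 1) ^ card J :: real)"
    by (rule sum.reindex_bij_witness[of _ "\<lambda>J. K - J" "\<lambda>I. K - I"]) (use R in \<open>auto simp: double_diff\<close>)
  also have "\<dots> = (\<Prod>i\<in>K - R. - 1 + 1)"
    using K by (subst prod_add) auto
  \<comment> \<open>The empty product, \<open>0 ^ 0 = 1\<close>, is exactly the case
    \<open>R = K\<close>.\<close>
  also have "\<dots> = (if R = K then 1 else 0)"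
    using K R by (auto simp: power_0_left)
  finally show ?thesis .
qed

text \<open>Inclusion-exclusion: a map is counted once, with sign, for every \<open>I\<close> that
  contains its image. These signs cancel unless the image is all of \<open>K\<close>.\<close>

lemma sum_alternating_PiE:
  fixes g :: "('k \<Rightarrow> 'k) \<Rightarrow> real"
  assumes K: "finite K"
  shows "(\<Sum>I\<in>Pow K. (- 1) ^ card (K - I) * (\<Sum>\<phi>\<in>K \<rightarrow>\<^sub>E I. g \<phi>))
    = (\<Sum>\<phi> | \<phi> \<in> K \<rightarrow>\<^sub>E K \<and> \<phi> ` K = K. g \<phi>)"
proof -
  have fin: "finite (K \<rightarrow>\<^sub>E K)" using K by (intro finite_PiE)
  \<comment> \<open>Moving the dependence on \<open>I\<close> from the range of summation into a
    condition makes the two sums exchangeable.\<close>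
  have "(\<Sum>I\<in>Pow K. (- 1) ^ card (K - I) * (\<Sum>\<phi>\<in>K \<rightarrow>\<^sub>E I. g \<phi>))
      = (\<Sum>I\<in>Pow K. \<Sum>\<phi>\<in>K \<rightarrow>\<^sub>E K. if \<phi> ` K \<subseteq> I then (- 1) ^ card (K - I) * g \<phi> else 0)"
  proof (intro sum.cong refl)
    fix I assume "I \<in> Pow K"
    then have "(K \<rightarrow>\<^sub>E K) \<inter> {\<phi>. \<phi> ` K \<subseteq> I} = K \<rightarrow>\<^sub>E I"
      by (auto simp: PiE_iff image_subset_iff)
    then show "(- 1) ^ card (K - I) * (\<Sum>\<phi>\<in>K \<rightarrow>\<^sub>E I. g \<phi>)
        = (\<Sum>\<phi>\<in>K \<rightarrow>\<^sub>E K. if \<phi> ` K \<subseteq> I then (- 1) ^ card (K - I) * g \<phi> else 0)"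
      using fin by (simp add: sum.If_cases sum_distrib_left)
  qed
  also have "\<dots> = (\<Sum>\<phi>\<in>K \<rightarrow>\<^sub>E K. \<Sum>I\<in>Pow K. if \<phi> ` K \<subseteq> I then (- 1) ^ card (K - I) * g \<phi> else 0)"
    by (rule sum.swap)
  also have "\<dots> = (\<Sum>\<phi>\<in>K \<rightarrow>\<^sub>E K. if \<phi> ` K = K then g \<phi> else 0)"
  proof (intro sum.cong refl)
    fix \<phi> assume "\<phi> \<in> K \<rightarrow>\<^sub>E K"
    then have R: "\<phi> ` K \<subseteq> K" by auto
    have "Pow K \<inter> {I. \<phi> ` K \<subseteq> I} = {I. \<phi> ` K \<subseteq> I \<and> I \<subseteq> K}" by auto
    then show "(\<Sum>I\<in>Pow K. if \<phi> ` K \<subseteq> I then (- 1) ^ card (K - I) * g \<phi> else 0)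
        = (if \<phi> ` K = K then g \<phi> else 0)"
      using K sum_alternating_supersets[OF K R]
      by (simp add: sum.If_cases flip: sum_distrib_right)
  qed
  also have "\<dots> = (\<Sum>\<phi> | \<phi> \<in> K \<rightarrow>\<^sub>E K \<and> \<phi> ` K = K. g \<phi>)"
    using fin by (simp add: sum.If_cases Int_def)
  finally show ?thesis .
qed

text \<open>Off \<open>K\<close> a permutation is the identity while an extensional map is
  \<open>undefined\<close>; the inverse refills with the identity. Surjective self-maps of a finite
  set are injective.\<close>

lemma bij_betw_restrict_permutes:
  assumes K: "finite K"
  shows "bij_betw (\<lambda>\<sigma>. restrict \<sigma> K) {\<sigma>. \<sigma> permutes K} {\<phi>. \<phi> \<in> K \<rightarrow>\<^sub>E K \<and> \<phi> ` K = K}"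
proof (rule bij_betw_byWitness[where f' = "\<lambda>\<phi> i. if i \<in> K then \<phi> i else i"])
  show "(\<lambda>\<phi> i. if i \<in> K then \<phi> i else i) ` {\<phi>. \<phi> \<in> K \<rightarrow>\<^sub>E K \<and> \<phi> ` K = K} \<subseteq> {\<sigma>. \<sigma> permutes K}"
  proof clarify
    fix \<phi> assume "\<phi> ` K = K"
    then have "bij_betw \<phi> K K"
      using K by (simp add: bij_betw_def finite_surj_inj)
    then show "(\<lambda>i. if i \<in> K then \<phi> i else i) permutes K"
      by (intro bij_imp_permutes) (auto cong: bij_betw_cong)
  qed
qed (auto simp: permutes_image permutes_in_image permutes_not_in PiE_iff extensional_def)

text \<open>Only permutations survive the alternating sum; there are \<open>fact n\<close> of them,
  and exchangeability gives each the same probability.\<close>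

lemma exchangeable_polarization:
  assumes ex: "exchangeable M S n X" and A: "A \<in> sets (PiM {1..n} (\<lambda>_. S))"
  shows "(\<Sum>I\<in>Pow {1..n}. (- 1) ^ card ({1..n} - I) *
      (\<Sum>\<phi>\<in>{1..n} \<rightarrow>\<^sub>E I. measure M {\<omega> \<in> space M. (\<lambda>i\<in>{1..n}. X (\<phi> i) \<omega>) \<in> A}))
    = fact n * measure M {\<omega> \<in> space M. (\<lambda>i\<in>{1..n}. X i \<omega>) \<in> A}" (is "_ = fact n * ?m")
proof -
  let ?K = "{1..n}"
  let ?g = "\<lambda>\<phi>. measure M {\<omega> \<in> space M. (\<lambda>i\<in>?K. X (\<phi> i) \<omega>) \<in> A}"
  have "(\<Sum>\<phi> | \<phi> \<in> ?K \<rightarrow>\<^sub>E ?K \<and> \<phi> ` ?K = ?K. ?g \<phi>) = (\<Sum>\<sigma> | \<sigma> permutes ?K. ?g (restrict \<sigma> ?K))"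
    by (rule sum.reindex_bij_betw[symmetric, OF bij_betw_restrict_permutes]) simp
  also have "\<dots> = (\<Sum>\<sigma> | \<sigma> permutes ?K. ?m)"
  proof (rule sum.cong[OF refl])
    fix \<sigma> assume "\<sigma> \<in> {\<sigma>. \<sigma> permutes ?K}"
    then have "?g \<sigma> = ?m" using ex A by (simp add: exchangeable_def)
    then show "?g (restrict \<sigma> ?K) = ?m" by (simp cong: restrict_cong)
  qed
  also have "\<dots> = fact n * ?m"
    using card_permutations[of ?K n] by simp
  finally show ?thesis
    by (simp add: sum_alternating_PiE)
qed

section \<open>Construction and verification of the mixing signed measure\<close>

theorem theorem1:
  fixes n :: nat
    and M :: "'a measure"
    and S :: "'s measure"
    and X :: "nat \<Rightarrow> 'a \<Rightarrow> 's"
  assumes "n > 0"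
    and "prob_space M"
    and "\<And>i. i \<in> {1..n} \<Longrightarrow> X i \<in> measurable M S"
    and "exchangeable M S n X"
  shows "\<exists>\<xi> :: 's measure set \<Rightarrow> real.
           bounded_signed_measure (prob_algebra S) \<xi> \<and>
           (\<forall>A\<in>sets (PiM {1..n} (\<lambda>_. S)).
              measure M {\<omega> \<in> space M. (\<lambda>i\<in>{1..n}. X i \<omega>) \<in> A} =
              signed_integral (prob_algebra S) \<xi>
                (\<lambda>\<pi>. measure (PiM {1..n} (\<lambda>_. \<pi>)) A))"
proof -
  interpret prob_space M by fact
  define K where "K = {1..n}"
  have K: "finite K" "card K = n" "K \<noteq> {}" using assms(1) by (auto simp: K_def)
  have X: "X i \<in> measurable M S" if "i \<in> K" for i using assms(3) that by (simp add: K_def)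
  \<comment> \<open>The empty set is left out because an empirical measure of no points is not a
    probability measure.\<close>
  define F where "F = Pow K - {{}}"
  have F: "finite I" "I \<noteq> {}" "I \<subseteq> K" if "I \<in> F" for I
    using that K finite_subset by (auto simp: F_def)
  define e where "e I \<omega> = empirical S I (\<lambda>i. X i \<omega>)" for I \<omega>
  have e: "e I \<in> measurable M (prob_algebra S)" if "I \<in> F" for I
    using F[OF that] X unfolding e_def by (intro measurable_empirical) auto
  \<comment> \<open>The sign comes from polarization, the power of \<open>card I\<close> undoes the
    normalization of the n-th power of the empirical measure, and \<open>fact n\<close> is the
    number of permutations.\<close>
  define c where "c I = (- 1) ^ card (K - I) * real (card I) ^ n / fact n" for I
  define \<mu> where "\<mu> I = distr M (prob_algebra S) (e I)" for I
  define \<xi> where "\<xi> B = (\<Sum>I\<in>F. c I * measure (\<mu> I) B)" for B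
  have finF: "finite F" using K by (simp add: F_def)
  have \<mu>: "sets (\<mu> I) = sets (prob_algebra S)" for I by (simp add: \<mu>_def)
  have fm: "finite_measure (\<mu> I)" if "I \<in> F" for I
    unfolding \<mu>_def by (intro finite_measure_distr e that)
  have "bounded_signed_measure (prob_algebra S) \<xi>"
    unfolding \<xi>_def by (rule bounded_signed_measure_sum[OF finF fm \<mu>])
  moreover have "measure M {\<omega> \<in> space M. (\<lambda>i\<in>K. X i \<omega>) \<in> A}
      = signed_integral (prob_algebra S) \<xi> (\<lambda>\<pi>. measure (PiM K (\<lambda>_. \<pi>)) A)"
    if A: "A \<in> sets (PiM K (\<lambda>_. S))" for A
  proof -
    let ?f = "\<lambda>\<pi>. measure (PiM K (\<lambda>_. \<pi>)) A"
    have f: "?f \<in> borel_measurable (prob_algebra S)"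
      by (rule measurable_compose[OF measurable_prob_algebraD[OF measurable_PiM_prob_algebra[OF K(1)]]
            measurable_measure_subprob_algebra[OF A]])
    have f_le: "?f \<pi> \<le> 1" if "\<pi> \<in> space (prob_algebra S)" for \<pi>
      using that by (intro prob_space.prob_le_1 prob_space_PiM) (simp add: space_prob_algebra)
    let ?g = "\<lambda>\<phi>. measure M {\<omega> \<in> space M. (\<lambda>i\<in>K. X (\<phi> i) \<omega>) \<in> A}"
    \<comment> \<open>Integrating against the law of \<open>e I\<close> is taking an expectation
      over \<open>M\<close>; there the power measure of \<open>A\<close> is an average of
      indicators, each with expectation \<open>?g \<phi>\<close>.\<close>
    have int: "(\<integral>\<pi>. ?f \<pi> \<partial>\<mu> I) = (\<Sum>\<phi>\<in>K \<rightarrow>\<^sub>E I. ?g \<phi>) / real (card I) ^ n" if I: "I \<in> F" for I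
    proof -
      have X\<phi>: "(\<lambda>\<omega>. \<lambda>i\<in>K. X (\<phi> i) \<omega>) \<in> measurable M (PiM K (\<lambda>_. S))" if "\<phi> \<in> K \<rightarrow>\<^sub>E I" for \<phi>
        using that F[OF I] X by (intro measurable_restrict) (auto simp: PiE_iff)
      have ind: "integrable M (\<lambda>\<omega>. indicat_real A (\<lambda>i\<in>K. X (\<phi> i) \<omega>))"
        "(\<integral>\<omega>. indicat_real A (\<lambda>i\<in>K. X (\<phi> i) \<omega>) \<partial>M) = ?g \<phi>" if "\<phi> \<in> K \<rightarrow>\<^sub>E I" for \<phi>
      proof -
        let ?B = "{\<omega> \<in> space M. (\<lambda>i\<in>K. X (\<phi> i) \<omega>) \<in> A}"
        have B: "?B \<in> sets M"
          using measurable_sets[OF X\<phi>[OF that] A] by (simp add: vimage_def Int_def conj_commute)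
        have eq: "indicat_real A (\<lambda>i\<in>K. X (\<phi> i) \<omega>) = indicat_real ?B \<omega>" if "\<omega> \<in> space M" for \<omega>
          using that by (simp add: indicator_def)
        have "integrable M (indicat_real ?B)" "(\<integral>\<omega>. indicat_real ?B \<omega> \<partial>M) = ?g \<phi>"
          using B sets.sets_into_space[OF B] by (simp_all add: Int_absorb2 less_top[symmetric])
        then show "integrable M (\<lambda>\<omega>. indicat_real A (\<lambda>i\<in>K. X (\<phi> i) \<omega>))"
          "(\<integral>\<omega>. indicat_real A (\<lambda>i\<in>K. X (\<phi> i) \<omega>) \<partial>M) = ?g \<phi>"
          using eq by (simp_all cong: Bochner_Integration.integrable_cong Bochner_Integration.integral_cong)
      qed
      have "(\<integral>\<pi>. ?f \<pi> \<partial>\<mu> I) = (\<integral>\<omega>. ?f (e I \<omega>) \<partial>M)"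
        unfolding \<mu>_def by (rule integral_distr[OF e[OF I] f])
      also have "\<dots> = (\<integral>\<omega>. (\<Sum>\<phi>\<in>K \<rightarrow>\<^sub>E I. indicator A (\<lambda>i\<in>K. X (\<phi> i) \<omega>)) / real (card I) ^ n \<partial>M)"
      proof (intro Bochner_Integration.integral_cong refl)
        fix \<omega> assume "\<omega> \<in> space M"
        then have x: "(\<lambda>i. X i \<omega>) \<in> I \<rightarrow> space S"
          using F[OF I] X by (auto dest: measurable_space)
        show "?f (e I \<omega>) = (\<Sum>\<phi>\<in>K \<rightarrow>\<^sub>E I. indicator A (\<lambda>i\<in>K. X (\<phi> i) \<omega>)) / real (card I) ^ n"
          unfolding e_def measure_PiM_empirical[OF K(1) F(1,2)[OF I] x A] K(2) ..
      qed
      also have "\<dots> = (\<Sum>\<phi>\<in>K \<rightarrow>\<^sub>E I. ?g \<phi>) / real (card I) ^ n"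
        using ind by simp
      finally show ?thesis .
    qed
    have "signed_integral (prob_algebra S) \<xi> ?f = (\<Sum>I\<in>F. c I * (\<integral>\<pi>. ?f \<pi> \<partial>\<mu> I))"
      unfolding \<xi>_def by (rule signed_integral_sum[OF finF fm \<mu> f _ f_le]) auto
    also have "\<dots> = (\<Sum>I\<in>F. (- 1) ^ card (K - I) * (\<Sum>\<phi>\<in>K \<rightarrow>\<^sub>E I. ?g \<phi>)) / fact n"
      unfolding sum_divide_distrib using F by (intro sum.cong) (auto simp: int c_def)
    \<comment> \<open>The empty set may now be restored: \<open>K\<close> is nonempty since
      \<open>n > 0\<close>, so no map from \<open>K\<close> to \<open>{}\<close> exists and its term
      is 0.\<close>
    also have "(\<Sum>I\<in>F. (- 1) ^ card (K - I) * (\<Sum>\<phi>\<in>K \<rightarrow>\<^sub>E I. ?g \<phi>))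
        = (\<Sum>I\<in>Pow K. (- 1) ^ card (K - I) * (\<Sum>\<phi>\<in>K \<rightarrow>\<^sub>E I. ?g \<phi>))"
      using K by (intro sum.mono_neutral_left) (auto simp: F_def PiE_eq_empty_iff)
    also have "\<dots> = fact n * measure M {\<omega> \<in> space M. (\<lambda>i\<in>K. X i \<omega>) \<in> A}"
      using exchangeable_polarization[OF assms(4)] A unfolding K_def by blast
    finally show ?thesis by simp
  qed
  ultimately show ?thesis unfolding K_def by blast
qed

end
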